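(* Let $\mathbb{G}$ be a risk-averse game with incomplete information. Suppose that for each player $i\in\mathcal{I}$ the interim risk preference is represented by a conditional risk functional $\rho^i(\cdot|\mathcal{F}^i_\tau):\mathcal{L}^\infty(T,\mathcal{F},P)\to\mathcal{L}^\infty(T,\mathcal{F}^i_\tau,P)$ which satisfies the conditional counterparts of monotonicity and convexity, i.e. (i) $\rho^i(L_1|\mathcal{F}^i_\tau)\le\rho^i(L_2|\mathcal{F}^i_\tau)$ almost surely whenever $L_1\le L_2$ almost surely; and (ii) $\rho^i((1-\alpha)L_1+\alpha L_2|\mathcal{F}^i_\tau)\le(1-\alpha)\rho^i(L_1|\mathcal{F}^i_\tau)+\alpha\rho^i(L_2|\mathcal{F}^i_\tau)$ almost surely, for all $L_1,L_2\in\mathcal{L}^\infty(T,\mathcal{F},P)$ and $0\le\alpha\le1$. Then a risk-averse Bayesian Nash equilibrium (RABNE) exists in $\mathbb{G}$.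
   Context: Game. $\mathcal{I}=\{1,\dots,I\}$, $I\ge2$, is a finite set of players. Each player $i$ has a non-empty finite set of types $T_i$ and a non-empty finite set of actions $A_i$; $T=\prod_i T_i$, $A=\prod_i A_i$. $\mathcal{F}$ is the $\sigma$-algebra of all subsets of $T$, and $P$ is a fully supported probability measure on $(T,\mathcal{F})$ (the common prior). Player $i$ has a bounded loss function $l^i:T\times A\to\mathbb{R}$; players minimize losses. The interim information of player $i$ is the sub-$\sigma$-algebra $\mathcal{F}^i_\tau\subset\mathcal{F}$ generated by the partition of $T$ into the cells $\{t\in T: \text{the } i\text{-th coordinate of } t \text{ is } t_i\}$, $t_i\in T_i$ (player $i$ observes her own type). Strategies. A (mixed/behavioral) strategy of player $i$ is a map $\beta_i:T_i\to\Delta(A_i)$, where $\Delta(A_i)$ is the set of probability distributions on $A_i$; $\Sigma_i$ is the set of these and $\Sigma=\prod_i\Sigma_i$. For $\beta\in\Sigma$, $\beta_{-i}$ is the profile of the other players' strategies; $(a_i,\beta_{-i})$ is the profile in which player $i$ plays the pure action $a_i\in A_i$ and the others play $\beta_{-i}$. Random loss. For $\beta\in\Sigma$, $L^i_\beta(t)=\sum_{a\in A}l^i(t,a)\prod_{j\in\mathcal{I}}\beta_j(a_j|t_j)$, a random variable on $T$. Conditional risk. For $L\in\mathcal{L}^\infty(T,\mathcal{F},P)$, $\rho^i(L|t_i)$ denotes the value of the $\mathcal{F}^i_\tau$-measurable random variable $\rho^i(L|\mathcal{F}^i_\tau)$ on the cell of $t_i$. As for conditional expectation, $\rho^i(L|t_i)$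 is the risk of $L$ evaluated given $t_i$, so it depends on $L$ only through its restriction to the cell of $t_i$. RABNE. $\beta^*\in\Sigma$ is a risk-averse Bayesian Nash equilibrium if for each $i\in\mathcal{I}$, each $t_i\in T_i$ and each $a_i\in A_i$, $\rho^i(L^i_{\beta^*}|t_i)\le\rho^i(L^i_{(a_i,\beta^*_{-i})}|t_i)$. *)

theory Defs
  imports "HOL-Probability.Probability"
begin

text \<open>
  Players are \<open>{1..I}\<close>. All players' types live in one type \<open>'t\<close> and all actions in one
  type \<open>'a\<close>; player \<open>i\<close> has the carriers \<open>T i\<close> and \<open>A i\<close>.
\<close>

definition profiles :: "nat \<Rightarrow> (nat \<Rightarrow> 'x set) \<Rightarrow> (nat \<Rightarrow> 'x) set" where
  "profiles I X = (\<Pi>\<^sub>E i\<in>{1..I}. X i)"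

definition incomplete_info_game ::
  "nat \<Rightarrow> (nat \<Rightarrow> 't set) \<Rightarrow> (nat \<Rightarrow> 'a set) \<Rightarrow> (nat \<Rightarrow> 't) measure
    \<Rightarrow> (nat \<Rightarrow> (nat \<Rightarrow> 't) \<Rightarrow> (nat \<Rightarrow> 'a) \<Rightarrow> real) \<Rightarrow> bool" where
  "incomplete_info_game I T A P l \<longleftrightarrow>
     2 \<le> I \<and>
     (\<forall>i\<in>{1..I}. finite (T i) \<and> T i \<noteq> {}) \<and>
     (\<forall>i\<in>{1..I}. finite (A i) \<and> A i \<noteq> {}) \<and>
     prob_space P \<and> space P = profiles I T \<and> sets P = Pow (profiles I T) \<and>
     (\<forall>t\<in>profiles I T. 0 < measure P {t}) \<and>
     (\<forall>i\<in>{1..I}. bounded {l i t a | t a. t \<in> profiles I T \<and> a \<in> profiles I A})"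


subsection \<open>Interim information and conditional risk\<close>

definition cell :: "nat \<Rightarrow> (nat \<Rightarrow> 't set) \<Rightarrow> nat \<Rightarrow> 't \<Rightarrow> (nat \<Rightarrow> 't) set" where
  "cell I T i s = {t \<in> profiles I T. t i = s}"

definition interim_info :: "nat \<Rightarrow> (nat \<Rightarrow> 't set) \<Rightarrow> nat \<Rightarrow> (nat \<Rightarrow> 't) measure" where
  "interim_info I T i = sigma (profiles I T) (cell I T i ` T i)"

text \<open>Elements of \<open>L\<^sup>\<infinity>\<close> are represented by functions, not by equivalence classes.\<close>

definition Linf :: "'x measure \<Rightarrow> ('x \<Rightarrow> real) set" where
  "Linf M = {f \<in> borel_measurable M. \<exists>C. AE x in M. \<bar>f x\<bar> \<le> C}"

definition Linf_interim ::
  "nat \<Rightarrow> (nat \<Rightarrow> 't set) \<Rightarrow> (nat \<Rightarrow> 't) measure \<Rightarrow> nat \<Rightarrow> ((nat \<Rightarrow> 't) \<Rightarrow> real) set" where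
  "Linf_interim I T P i = Linf (restr_to_subalg P (interim_info I T i))"

text \<open>
  The value of a random variable on a cell. It is meaningful for random variables that are
  constant on each cell, such as those measurable with respect to the interim information;
  see \<open>cell_value_eq\<close> below.
\<close>

definition cell_value ::
  "nat \<Rightarrow> (nat \<Rightarrow> 't set) \<Rightarrow> nat \<Rightarrow> ((nat \<Rightarrow> 't) \<Rightarrow> real) \<Rightarrow> 't \<Rightarrow> real" where
  "cell_value I T i X s = (THE v. \<forall>t\<in>cell I T i s. X t = v)"

text \<open>
  The last conjunct is locality: the risk conditional on a type of player \<open>i\<close> depends on the loss
  only through its restriction to the cell of that type.
\<close>

definition conditional_risk_functional ::
  "nat \<Rightarrow> (nat \<Rightarrow> 't set) \<Rightarrow> (nat \<Rightarrow> 't) measure \<Rightarrow> nat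
    \<Rightarrow> (((nat \<Rightarrow> 't) \<Rightarrow> real) \<Rightarrow> ((nat \<Rightarrow> 't) \<Rightarrow> real)) \<Rightarrow> bool" where
  "conditional_risk_functional I T P i R \<longleftrightarrow>
     R \<in> Linf P \<rightarrow> Linf_interim I T P i \<and>
     (\<forall>s\<in>T i. \<forall>L1\<in>Linf P. \<forall>L2\<in>Linf P.
        (\<forall>t\<in>cell I T i s. L1 t = L2 t) \<longrightarrow>
        cell_value I T i (R L1) s = cell_value I T i (R L2) s)"


subsection \<open>Strategies and equilibrium\<close>

definition strategies :: "'t set \<Rightarrow> 'a set \<Rightarrow> ('t \<Rightarrow> 'a pmf) set" where
  "strategies S B = (\<Pi>\<^sub>E s\<in>S. {p. set_pmf p \<subseteq> B})"

definition strategy_profiles ::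
  "nat \<Rightarrow> (nat \<Rightarrow> 't set) \<Rightarrow> (nat \<Rightarrow> 'a set) \<Rightarrow> (nat \<Rightarrow> 't \<Rightarrow> 'a pmf) set" where
  "strategy_profiles I T A = profiles I (\<lambda>i. strategies (T i) (A i))"

definition deviation ::
  "(nat \<Rightarrow> 't set) \<Rightarrow> (nat \<Rightarrow> 't \<Rightarrow> 'a pmf) \<Rightarrow> nat \<Rightarrow> 'a \<Rightarrow> (nat \<Rightarrow> 't \<Rightarrow> 'a pmf)" where
  "deviation T \<beta> i b = \<beta>(i := (\<lambda>s\<in>T i. return_pmf b))"

definition random_loss ::
  "nat \<Rightarrow> (nat \<Rightarrow> 'a set) \<Rightarrow> (nat \<Rightarrow> (nat \<Rightarrow> 't) \<Rightarrow> (nat \<Rightarrow> 'a) \<Rightarrow> real)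
    \<Rightarrow> nat \<Rightarrow> (nat \<Rightarrow> 't \<Rightarrow> 'a pmf) \<Rightarrow> (nat \<Rightarrow> 't) \<Rightarrow> real" where
  "random_loss I A l i \<beta> t =
     (\<Sum>a\<in>profiles I A. l i t a * (\<Prod>j\<in>{1..I}. pmf (\<beta> j (t j)) (a j)))"

definition RABNE ::
  "nat \<Rightarrow> (nat \<Rightarrow> 't set) \<Rightarrow> (nat \<Rightarrow> 'a set) \<Rightarrow> (nat \<Rightarrow> (nat \<Rightarrow> 't) \<Rightarrow> (nat \<Rightarrow> 'a) \<Rightarrow> real)
    \<Rightarrow> (nat \<Rightarrow> ((nat \<Rightarrow> 't) \<Rightarrow> real) \<Rightarrow> ((nat \<Rightarrow> 't) \<Rightarrow> real))
    \<Rightarrow> (nat \<Rightarrow> 't \<Rightarrow> 'a pmf) \<Rightarrow> bool" where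
  "RABNE I T A l \<rho> \<beta> \<longleftrightarrow>
     \<beta> \<in> strategy_profiles I T A \<and>
     (\<forall>i\<in>{1..I}. \<forall>s\<in>T i. \<forall>b\<in>A i.
        cell_value I T i (\<rho> i (random_loss I A l i \<beta>)) s
          \<le> cell_value I T i (\<rho> i (random_loss I A l i (deviation T \<beta> i b))) s)"


subsection \<open>Well-definedness of values on cells\<close>

lemma sets_restr_interim_info:
  assumes "sets P = Pow (profiles I T)" "space P = profiles I T"
  shows "sets (restr_to_subalg P (interim_info I T i)) =
           sigma_sets (profiles I T) (cell I T i ` T i)"
proof -
  have sub: "cell I T i ` T i \<subseteq> Pow (profiles I T)"
    by (auto simp: cell_def)
  have s: "sets (interim_info I T i) = sigma_sets (profiles I T) (cell I T i ` T i)"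
    unfolding interim_info_def by (rule sets_measure_of[OF sub])
  have sp: "space (interim_info I T i) = profiles I T"
    unfolding interim_info_def by (rule space_measure_of[OF sub])
  have "subalgebra P (interim_info I T i)"
    unfolding subalgebra_def assms sp s using sigma_sets_into_sp[OF sub] by blast
  then show ?thesis
    unfolding s[symmetric] by (rule sets_restr_to_subalg)
qed

lemma sigma_sets_cell_invariant:
  assumes "B \<in> sigma_sets (profiles I T) (cell I T i ` T i)"
    and "t \<in> cell I T i s" "u \<in> cell I T i s"
  shows "t \<in> B \<longleftrightarrow> u \<in> B"
  using assms(1)
proof (induction rule: sigma_sets.induct)
  case (Compl B)
  then show ?case
    using assms(2,3) unfolding cell_def by blast
qed (use assms(2,3) in \<open>auto simp: cell_def\<close>)

lemma cell_value_eq: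
  assumes P: "sets P = Pow (profiles I T)" "space P = profiles I T"
    and X: "X \<in> Linf_interim I T P i"
    and t: "t \<in> cell I T i s"
  shows "cell_value I T i X s = X t"
proof -
  let ?M = "restr_to_subalg P (interim_info I T i)"
  have sp: "space ?M = profiles I T"
    by (simp only: space_restr_to_subalg P)
  have "X \<in> borel_measurable ?M"
    using X unfolding Linf_interim_def Linf_def by blast
  then have "X -` {X t} \<inter> space ?M \<in> sets ?M"
    by (rule measurable_sets) simp
  then have B: "X -` {X t} \<inter> profiles I T \<in> sigma_sets (profiles I T) (cell I T i ` T i)"
    unfolding sp sets_restr_interim_info[OF P] .
  have *: "X u = X t" if "u \<in> cell I T i s" for u
    using sigma_sets_cell_invariant[OF B t that] t unfolding cell_def by blast
  show ?thesis
    unfolding cell_value_def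
  proof (rule the_equality)
    show "\<forall>u\<in>cell I T i s. X u = X t"
      using * by blast
    show "v = X t" if "\<forall>u\<in>cell I T i s. X u = v" for v
      using bspec[OF that t] by (rule sym)
  qed
qed

end

theory Submission
  imports Defs
begin

text \<open>
  A monotone convex functional on a finite-dimensional space is automatically continuous. Hence the
  map with which Nash proved the existence of equilibria, applied to the agent-form game whose agents
  are the pairs of a player and one of her types, is continuous and has a fixed point by Brouwer's
  theorem. At a fixed point with a strictly profitable pure deviation, every action in the support
  would be strictly profitable, contradicting Jensen's inequality for the conditional risk.
\<close>

section \<open>Brouwer's theorem for cubes of functions\<close>

lemma tendsto_fun_iff:
  fixes X :: "'y \<Rightarrow> 'k \<Rightarrow> 'b::topological_space"
  shows "(X \<longlongrightarrow> x) F \<longleftrightarrow> (\<forall>k. ((\<lambda>y. X y k) \<longlongrightarrow> x k) F)"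
proof -
  have "(X \<longlongrightarrow> x) F \<longleftrightarrow> limitin (product_topology (\<lambda>_. euclidean) UNIV) X x F"
    by (simp add: euclidean_product_topology)
  also have "\<dots> \<longleftrightarrow> (\<forall>k. ((\<lambda>y. X y k) \<longlongrightarrow> x k) F)"
    by (simp add: limitin_componentwise)
  finally show ?thesis .
qed

text \<open>Tychonoff's theorem, the function type carrying the product topology.\<close>

lemma compact_Pi_UNIV:
  fixes S :: "'b::topological_space set"
  assumes "compact S"
  shows "compact ((UNIV :: 'k set) \<rightarrow> S)"
proof -
  have "compactin (product_topology (\<lambda>_. euclidean) UNIV) (PiE (UNIV :: 'k set) (\<lambda>_. S))"
    using assms by (simp add: compactin_PiE)
  then show ?thesis
    by (simp add: euclidean_product_topology PiE_UNIV_domain)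
qed

text \<open>Kuhn's proof of Brouwer's theorem, with the dimension \<open>n\<close> a number: the
  first \<open>n\<close> coordinates are discretised, and compactness of the whole Hilbert cube
  produces the limit point.\<close>

lemma brouwer_Hilbert_cube_coordinates:
  fixes f :: "(nat \<Rightarrow> real) \<Rightarrow> nat \<Rightarrow> real"
  assumes cont: "continuous_on (UNIV \<rightarrow> {0..1}) f"
    and f: "f \<in> (UNIV \<rightarrow> {0..1}) \<rightarrow> (UNIV \<rightarrow> {0..1})"
  shows "\<exists>x \<in> UNIV \<rightarrow> {0..1}. \<forall>i<n. f x i = x i"
proof -
  define S :: "(nat \<Rightarrow> real) set" where "S = UNIV \<rightarrow> {0..1}"
  have fS: "x \<in> S \<Longrightarrow> f x \<in> S" for x
    using f unfolding S_def by blast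
  have S_iff: "x \<in> S \<longleftrightarrow> (\<forall>i. 0 \<le> x i \<and> x i \<le> 1)" for x
    by (auto simp: S_def Pi_iff)
  \<comment> \<open>Label 0 marks a coordinate that \<open>f\<close> does not decrease, label 1 one
    that it does not increase. On opposite faces of the cube the label is forced, as Kuhn's lemma
    requires.\<close>
  obtain lab :: "(nat \<Rightarrow> real) \<Rightarrow> nat \<Rightarrow> nat" where lab:
    "\<And>x i. lab x i \<le> 1"
    "\<And>x i. x \<in> S \<Longrightarrow> x i = 0 \<Longrightarrow> lab x i = 0"
    "\<And>x i. x \<in> S \<Longrightarrow> x i = 1 \<Longrightarrow> lab x i = 1"
    "\<And>x i. x \<in> S \<Longrightarrow> lab x i = 0 \<Longrightarrow> x i \<le> f x i"
    "\<And>x i. x \<in> S \<Longrightarrow> lab x i = 1 \<Longrightarrow> f x i \<le> x i"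
  proof -
    have "\<forall>x. x \<in> S \<longrightarrow> f x \<in> S" "\<forall>x. x \<in> S \<longrightarrow> (\<forall>i. True \<longrightarrow> 0 \<le> x i \<and> x i \<le> 1)"
      using fS S_iff by blast+
    from kuhn_labelling_lemma'[OF this] show ?thesis
      by (elim exE conjE) (rule that; blast)
  qed
  \<comment> \<open>The mesh width is \<open>1 / Suc m\<close>, never a division by zero; the
    coordinates from \<open>n\<close> on are filled with 0 to give a point of the Hilbert
    cube.\<close>
  define grid :: "nat \<Rightarrow> (nat \<Rightarrow> nat) \<Rightarrow> nat \<Rightarrow> real" where
    "grid m x i = (if i < n then real (x i) / real (Suc m) else 0)" for m x i
  have gridS: "grid m x \<in> S" if "\<forall>i<n. x i \<le> Suc m" for m x
    using that unfolding S_iff grid_def by (auto simp: divide_le_eq_1)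
  define near :: "(nat \<Rightarrow> nat) \<Rightarrow> (nat \<Rightarrow> nat) \<Rightarrow> bool" where
    "near q r \<longleftrightarrow> (\<forall>j<n. q j \<le> r j \<and> r j \<le> q j + 1)" for q r
  \<comment> \<open>Kuhn's combinatorial lemma: some cell of the grid, with lower corner
    \<open>q\<close>, has for every coordinate two vertices with different labels.\<close>
  have "\<exists>q. (\<forall>i<n. q i < Suc m) \<and>
      (\<forall>i<n. \<exists>r s. near q r \<and> near q s \<and> lab (grid m r) i \<noteq> lab (grid m s) i)" for m
  proof -
    have 1: "\<forall>x. (\<forall>i<n. x i \<le> Suc m) \<longrightarrow> (\<forall>i<n. lab (grid m x) i = 0 \<or> lab (grid m x) i = 1)"
      using lab(1) by (auto simp: le_Suc_eq)
    have 2: "\<forall>x. (\<forall>i<n. x i \<le> Suc m) \<longrightarrow> (\<forall>i<n. x i = 0 \<longrightarrow> lab (grid m x) i = 0)"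
      using lab(2)[OF gridS] by (simp add: grid_def)
    have 3: "\<forall>x. (\<forall>i<n. x i \<le> Suc m) \<longrightarrow> (\<forall>i<n. x i = Suc m \<longrightarrow> lab (grid m x) i = 1)"
      using lab(3)[OF gridS] by (simp add: grid_def)
    show ?thesis
      unfolding near_def
      by (rule kuhn_lemma[of "Suc m" n "\<lambda>x. lab (grid m x)", OF _ 1 2 3]) (simp, blast)
  qed
  then obtain q where q: "\<And>m i. i < n \<Longrightarrow> q m i < Suc m"
    and rs: "\<And>m i. i < n \<Longrightarrow>
      \<exists>r s. near (q m) r \<and> near (q m) s \<and> lab (grid m r) i \<noteq> lab (grid m s) i"
    by metis
  \<comment> \<open>A subsequential limit of the lower corners is the candidate for the fixed
    point.\<close>
  have "compact S"
    unfolding S_def by (rule compact_Pi_UNIV) simp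
  then have "seq_compact S"
    by (rule compact_imp_seq_compact)
  moreover have "\<forall>m. grid m (q m) \<in> S"
    by (intro allI gridS impI less_imp_le q)
  ultimately obtain x \<phi> where x: "x \<in> S" and \<phi>: "strict_mono \<phi>"
    and lim: "((\<lambda>m. grid m (q m)) \<circ> \<phi>) \<longlonglongrightarrow> x"
    by (rule seq_compactE)
  \<comment> \<open>The strict bound \<open>q m i < Suc m\<close> leaves room for the vertices one
    step further.\<close>
  have nearS: "grid m x \<in> S" if "near (q m) x" for m x
  proof (intro gridS allI impI)
    fix j assume j: "j < n"
    show "x j \<le> Suc m"
      using q[OF j, of m] that[unfolded near_def, rule_format, OF j] by linarith
  qed
  \<comment> \<open>Every vertex lies within one mesh width of the lower corner in each coordinate,
    so any choice of vertices has the same limit \<open>x\<close>, and continuity carries this over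
    to \<open>f\<close>.\<close>
  have corner: "(\<lambda>m. f (grid (\<phi> m) (r m)) i) \<longlonglongrightarrow> f x i \<and> (\<lambda>m. grid (\<phi> m) (r m) i) \<longlonglongrightarrow> x i"
    if "\<And>m. near (q (\<phi> m)) (r m)" for r i
  proof -
    have r: "q (\<phi> m) j \<le> r m j \<and> r m j \<le> q (\<phi> m) j + 1" if "j < n" for m j
      using \<open>near (q (\<phi> m)) (r m)\<close> that by (simp add: near_def)
    note rS = nearS[OF that]
    have "(\<lambda>m. grid (\<phi> m) (r m) j) \<longlonglongrightarrow> x j" for j
    proof (rule tendsto_sandwich)
      have lj: "(\<lambda>m. grid (\<phi> m) (q (\<phi> m)) j) \<longlonglongrightarrow> x j"
        using lim by (simp add: tendsto_fun_iff o_def)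
      then show "(\<lambda>m. grid (\<phi> m) (q (\<phi> m)) j) \<longlonglongrightarrow> x j" .
      have "(\<lambda>m. 1 / real (Suc (\<phi> m))) \<longlonglongrightarrow> 0"
        using LIMSEQ_subseq_LIMSEQ[OF LIMSEQ_inverse_real_of_nat \<phi>]
        by (simp add: o_def inverse_eq_divide)
      from tendsto_add[OF lj this]
      show "(\<lambda>m. grid (\<phi> m) (q (\<phi> m)) j + 1 / real (Suc (\<phi> m))) \<longlonglongrightarrow> x j"
        by simp
      show "\<forall>\<^sub>F m in sequentially. grid (\<phi> m) (q (\<phi> m)) j \<le> grid (\<phi> m) (r m) j"
        using r by (intro always_eventually) (simp add: grid_def divide_right_mono)
      have "grid (\<phi> m) (r m) j \<le> grid (\<phi> m) (q (\<phi> m)) j + 1 / real (Suc (\<phi> m))" for m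
      proof (cases "j < n")
        case True
        then have "real (r m j) \<le> real (q (\<phi> m) j) + 1"
          using r[of j m] by linarith
        then have "real (r m j) / real (Suc (\<phi> m)) \<le> (real (q (\<phi> m) j) + 1) / real (Suc (\<phi> m))"
          by (rule divide_right_mono) simp
        with True show ?thesis
          by (simp only: grid_def if_True add_divide_distrib)
      qed (simp add: grid_def)
      then show "\<forall>\<^sub>F m in sequentially.
          grid (\<phi> m) (r m) j \<le> grid (\<phi> m) (q (\<phi> m)) j + 1 / real (Suc (\<phi> m))"
        by simp
    qed
    then have g: "(\<lambda>m. grid (\<phi> m) (r m)) \<longlonglongrightarrow> x"
      by (simp add: tendsto_fun_iff)
    have "(\<lambda>m. f (grid (\<phi> m) (r m))) \<longlonglongrightarrow> f x"
      using continuous_on_tendsto_compose[OF cont g] x rS by (simp add: S_def)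
    with g show ?thesis
      by (simp add: tendsto_fun_iff)
  qed
  \<comment> \<open>Of two differing labels one is 0 and one is 1. Along the vertices labelled 0 the
    limit gives \<open>x i \<le> f x i\<close>, along those labelled 1 the reverse.\<close>
  have "f x i = x i" if i: "i < n" for i
  proof -
    have "\<exists>r s. near (q m) r \<and> near (q m) s \<and> lab (grid m r) i = 0 \<and> lab (grid m s) i = 1" for m
    proof -
      have 01: "lab z i = 0 \<or> lab z i = 1" for z
        using lab(1)[of z i] by linarith
      from rs[OF i, of m] obtain r s where "near (q m) r" "near (q m) s"
          "lab (grid m r) i \<noteq> lab (grid m s) i"
        by blast
      with 01[of "grid m r"] 01[of "grid m s"] show ?thesis
        by metis
    qed
    then obtain r s where r: "\<And>m. near (q m) (r m)" and s: "\<And>m. near (q m) (s m)"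
      and r0: "\<And>m. lab (grid m (r m)) i = 0" and s1: "\<And>m. lab (grid m (s m)) i = 1"
      by metis
    note rS = nearS[OF r] and sS = nearS[OF s]
    note cr = corner[of "\<lambda>m. r (\<phi> m)" i, OF r] and cs = corner[of "\<lambda>m. s (\<phi> m)" i, OF s]
    have "x i \<le> f x i"
      using lab(4)[OF rS r0] cr by (intro LIMSEQ_le[of _ "x i" _ "f x i"]) auto
    moreover have "f x i \<le> x i"
      using lab(5)[OF sS s1] cs by (intro LIMSEQ_le[of _ "f x i" _ "x i"]) auto
    ultimately show ?thesis by simp
  qed
  with x show ?thesis
    unfolding S_def by blast
qed

text \<open>Enumerating \<open>K\<close> turns its coordinates into the first \<open>card K\<close>
  of the Hilbert cube.\<close>

lemma brouwer_cube_coordinates: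
  fixes f :: "('k \<Rightarrow> real) \<Rightarrow> 'k \<Rightarrow> real"
  assumes K: "finite K"
    and cont: "\<And>k. k \<in> K \<Longrightarrow> continuous_on (UNIV \<rightarrow> {0..1}) (\<lambda>x. f x k)"
    and f: "\<And>x k. x \<in> UNIV \<rightarrow> {0..1} \<Longrightarrow> k \<in> K \<Longrightarrow> f x k \<in> {0..1}"
  shows "\<exists>x \<in> UNIV \<rightarrow> {0..1}. \<forall>k\<in>K. f x k = x k"
proof -
  obtain e where e: "bij_betw e K {..<card K}"
    using ex_bij_betw_finite_nat[OF K] by (auto simp: atLeast0LessThan)
  define g where "g = inv_into K e"
  have gK: "g i \<in> K" if "i < card K" for i
    using e that unfolding g_def by (metis bij_betw_def inv_into_into lessThan_iff)
  have ge: "g (e k) = k" if "k \<in> K" for k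
    using e that unfolding g_def by (metis bij_betw_def inv_into_f_f)
  have eK: "e k < card K" if "k \<in> K" for k
    using e that by (metis bij_betwE lessThan_iff)
  \<comment> \<open>Outside \<open>K\<close> the map \<open>pull\<close> reads some coordinate or
    other, which still lies in the unit interval; \<open>h\<close> is padded with 0 to stay in the
    cube as well.\<close>
  define pull :: "(nat \<Rightarrow> real) \<Rightarrow> 'k \<Rightarrow> real" where "pull x = (\<lambda>k. x (e k))" for x
  define h where "h x = (\<lambda>i. if i < card K then f (pull x) (g i) else 0)" for x
  have pull: "pull x \<in> UNIV \<rightarrow> {0..1}" if "x \<in> UNIV \<rightarrow> {0..1}" for x
    using that by (auto simp: pull_def Pi_iff)
  have contpull: "continuous_on (UNIV \<rightarrow> {0..1}) pull"
    unfolding pull_def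
    by (intro continuous_on_coordinatewise_then_product
        continuous_on_subset[OF continuous_on_product_coordinates]) simp
  have "continuous_on (UNIV \<rightarrow> {0..1}) h"
    unfolding h_def
  proof (rule continuous_on_coordinatewise_then_product)
    show "continuous_on (UNIV \<rightarrow> {0..1}) (\<lambda>x. if i < card K then f (pull x) (g i) else 0)" for i
      using continuous_on_compose2[OF cont[OF gK] contpull] pull by (cases "i < card K") auto
  qed
  moreover have "h \<in> (UNIV \<rightarrow> {0..1}) \<rightarrow> (UNIV \<rightarrow> {0..1})"
    using f[OF pull gK] by (simp add: h_def Pi_iff)
  ultimately obtain x where x: "x \<in> UNIV \<rightarrow> {0..1}" "\<forall>i<card K. h x i = x i"
    using brouwer_Hilbert_cube_coordinates by blast
  then have "f (pull x) k = pull x k" if "k \<in> K" for k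
    using that eK[OF that] ge[OF that] unfolding h_def by (metis pull_def)
  with pull[OF x(1)] show ?thesis by blast
qed

section \<open>Nash's map\<close>

text \<open>The indices \<open>m\<close> are the agents, \<open>y (m, b)\<close> is the weight that
  \<open>m\<close> puts on \<open>b\<close>, \<open>c m y\<close> is her cost and
  \<open>d m b y\<close> her cost after switching to \<open>b\<close>. In Nash's setting the cost of
  a mixture equals the average of the pure costs; a convex risk gives only the inequality
  \<open>jensen\<close>, which is the direction that minimisers need.\<close>

lemma exists_no_profitable_pure_deviation:
  fixes c :: "'m \<Rightarrow> ('m \<times> 'b \<Rightarrow> real) \<Rightarrow> real"
    and d :: "'m \<Rightarrow> 'b \<Rightarrow> ('m \<times> 'b \<Rightarrow> real) \<Rightarrow> real"
  assumes J: "finite J"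
    and B: "\<And>m. m \<in> J \<Longrightarrow> finite (B m)" "\<And>m. m \<in> J \<Longrightarrow> B m \<noteq> {}"
    and contc: "\<And>m. m \<in> J \<Longrightarrow> continuous_on UNIV (c m)"
    and contd: "\<And>m b. m \<in> J \<Longrightarrow> b \<in> B m \<Longrightarrow> continuous_on UNIV (d m b)"
    and jensen: "\<And>m y. m \<in> J \<Longrightarrow> (\<And>b. b \<in> B m \<Longrightarrow> 0 \<le> y (m, b)) \<Longrightarrow>
      (\<Sum>b\<in>B m. y (m, b)) = 1 \<Longrightarrow> c m y \<le> (\<Sum>b\<in>B m. y (m, b) * d m b y)"
  obtains y where "\<And>m b. m \<in> J \<Longrightarrow> b \<in> B m \<Longrightarrow> 0 \<le> y (m, b)"
    and "\<And>m. m \<in> J \<Longrightarrow> (\<Sum>b\<in>B m. y (m, b)) = 1"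
    and "\<And>m b. m \<in> J \<Longrightarrow> b \<in> B m \<Longrightarrow> c m y \<le> d m b y"
proof -
  let ?S = "(UNIV \<rightarrow> {0..1}) :: ('m \<times> 'b \<Rightarrow> real) set"
  define tot where "tot m y = (\<Sum>b\<in>B m. y (m, b))" for m and y :: "'m \<times> 'b \<Rightarrow> real"
  \<comment> \<open>Giving the missing mass to every action of \<open>m\<close> makes the divisor
    \<open>den\<close> at least 1 even at \<open>y = 0\<close>, so normalising is continuous on the
    cube; blocks that already sum to 1 are unchanged.\<close>
  define gap where "gap m y = max 0 (1 - tot m y)" for m y
  define den where "den m y = tot m y + real (card (B m)) * gap m y" for m y
  \<comment> \<open>a retraction of the cube onto the product of the simplices\<close>
  define ret where "ret y = (\<lambda>(m, b). if m \<in> J then (y (m, b) + gap m y) / den m y else 0)" for y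
  define gain where "gain m b y = max 0 (c m y - d m b y)" for m b y
  \<comment> \<open>Nash's map after the retraction: weight shifts toward the actions with positive
    gain, and the divisor restores the total 1.\<close>
  define F where "F y = (\<lambda>(m, b). (ret y (m, b) + gain m b (ret y)) /
      (1 + (\<Sum>b\<in>B m. gain m b (ret y))))" for y
  have gain0: "0 \<le> gain m b y" for m b y
    by (simp add: gain_def)
  have den: "1 \<le> den m y" if m: "m \<in> J" for m y
  proof -
    have "1 \<le> card (B m)"
      using B[OF m] by (simp add: Suc_le_eq card_gt_0_iff)
    then have "1 * gap m y \<le> real (card (B m)) * gap m y"
      by (intro mult_right_mono) (auto simp: gap_def)
    moreover have "1 - tot m y \<le> gap m y"
      by (simp add: gap_def)
    ultimately show ?thesis
      unfolding den_def by linarith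
  qed
  have ret_nonneg: "0 \<le> ret y (m, b)" if "y \<in> ?S" "m \<in> J" for y m b
    using that den[of m y] by (auto simp: ret_def gap_def Pi_iff)
  have ret_sum: "(\<Sum>b\<in>B m. ret y (m, b)) = 1" if m: "m \<in> J" for y m
  proof -
    have "(\<Sum>b\<in>B m. ret y (m, b)) = (\<Sum>b\<in>B m. y (m, b) + gap m y) / den m y"
      using m by (simp add: ret_def sum_divide_distrib)
    also have "(\<Sum>b\<in>B m. y (m, b) + gap m y) = den m y"
      by (simp add: sum.distrib den_def tot_def)
    finally show ?thesis using den[OF m, of y] by simp
  qed
  have sumF: "(\<Sum>b\<in>B m. F y (m, b)) = 1" if m: "m \<in> J" for y m
  proof -
    have "0 \<le> (\<Sum>b\<in>B m. gain m b (ret y))"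
      by (intro sum_nonneg gain0)
    then show ?thesis
      using ret_sum[OF m, of y] by (simp add: F_def sum_divide_distrib[symmetric] sum.distrib)
  qed
  have F0: "0 \<le> F y (m, b)" if "y \<in> ?S" "m \<in> J" for y m b
    using ret_nonneg[OF that] by (simp add: F_def gain0 sum_nonneg)
  have conttot: "continuous_on X (tot m)" for m X
    unfolding tot_def
    by (intro continuous_intros continuous_on_subset[OF continuous_on_product_coordinates]) simp
  have contret: "continuous_on ?S ret"
  proof (rule continuous_on_coordinatewise_then_product)
    fix k :: "'m \<times> 'b"
    obtain m b where k: "k = (m, b)" by fastforce
    show "continuous_on ?S (\<lambda>y. ret y k)"
    proof (cases "m \<in> J")
      case True
      then have "\<forall>y\<in>?S. den m y \<noteq> 0"
        using den by (metis not_one_le_zero)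
      then show ?thesis
        using True unfolding k ret_def den_def gap_def
        by (auto intro!: continuous_intros conttot
            continuous_on_subset[OF continuous_on_product_coordinates])
    qed (simp add: k ret_def)
  qed
  have contgain: "continuous_on ?S (\<lambda>y. gain m b (ret y))" if "m \<in> J" "b \<in> B m" for m b
    unfolding gain_def using that
    by (intro continuous_intros continuous_on_compose2[OF contc contret]
        continuous_on_compose2[OF contd contret]) auto
  have contF: "continuous_on ?S (\<lambda>y. F y (m, b))" if "m \<in> J" "b \<in> B m" for m b
  proof -
    have "1 + (\<Sum>b\<in>B m. gain m b (ret y)) \<noteq> 0" for y
      using sum_nonneg[of "B m" "\<lambda>b. gain m b (ret y)"] gain0 by (metis add_nonneg_eq_0_iff zero_le_one zero_neq_one)
    then show ?thesis
      unfolding F_def using that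
      by (auto intro!: continuous_intros contgain continuous_on_product_then_coordinatewise[OF contret])
  qed
  have F1: "F y (m, b) \<le> 1" if "y \<in> ?S" "m \<in> J" "b \<in> B m" for y m b
    using member_le_sum[of b "B m" "\<lambda>b. F y (m, b)"] B(1) F0[OF that(1)] sumF[OF that(2), of y] that
    by auto
  obtain y where y: "y \<in> ?S" and fixp: "\<forall>k\<in>Sigma J B. F y k = y k"
    using brouwer_cube_coordinates[of "Sigma J B" F] J B(1) contF F0 F1 by fastforce
  \<comment> \<open>The witness is \<open>ret y\<close>, not \<open>y\<close>: the gains in
    \<open>F\<close> are evaluated there, and \<open>y\<close> is not controlled at indices outside
    \<open>J\<close>.\<close>
  define z where "z = ret y"
  \<comment> \<open>The blocks of \<open>F y\<close> sum to 1, hence so do those of the fixed point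
    \<open>y\<close>, and \<open>ret\<close> leaves them alone.\<close>
  have zy: "z (m, b) = y (m, b)" if m: "m \<in> J" and b: "b \<in> B m" for m b
  proof -
    have "tot m y = (\<Sum>b\<in>B m. F y (m, b))"
      unfolding tot_def using fixp m by (intro sum.cong) auto
    then have "tot m y = 1"
      using sumF[OF m] by simp
    then show ?thesis
      using m by (simp add: z_def ret_def den_def gap_def)
  qed
  show thesis
  proof (rule that[of z])
    show z0: "0 \<le> z (m, b)" if "m \<in> J" "b \<in> B m" for m b
      using that ret_nonneg[OF y] by (simp add: z_def)
    show z1: "(\<Sum>b\<in>B m. z (m, b)) = 1" if "m \<in> J" for m
      using ret_sum[OF that] by (simp add: z_def)
    show "c m z \<le> d m b z" if m: "m \<in> J" and b: "b \<in> B m" for m b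
    proof (rule ccontr)
      assume neg: "\<not> c m z \<le> d m b z"
      define G where "G = (\<Sum>b\<in>B m. gain m b z)"
      have "gain m b z \<le> G"
        unfolding G_def using B(1) m b by (intro member_le_sum) (auto simp: gain0)
      with neg have G: "0 < G"
        unfolding gain_def by linarith
      \<comment> \<open>Clear the divisor \<open>1 + G\<close> from the fixed point equation. Since
        \<open>G\<close> is positive, an action has positive weight exactly when it has positive
        gain.\<close>
      have eq: "z (m, b') * G = gain m b' z" if b': "b' \<in> B m" for b'
      proof -
        have "z (m, b') = (z (m, b') + gain m b' z) / (1 + G)"
          using bspec[OF fixp, of "(m, b')"] m b' zy[OF m b'] by (simp add: F_def z_def G_def)
        with G show ?thesis
          by (simp add: field_simps)
      qed
      have le: "z (m, b') * d m b' z \<le> z (m, b') * c m z" if b': "b' \<in> B m" for b'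
      proof (cases "z (m, b') = 0")
        case False
        then have "0 < gain m b' z"
          using eq[OF b'] z0[OF m b'] G by (metis less_eq_real_def mult_pos_pos)
        then have "d m b' z \<le> c m z"
          unfolding gain_def by linarith
        then show ?thesis
          using z0[OF m b'] by (rule mult_left_mono)
      qed simp
      \<comment> \<open>The profitable \<open>b\<close> itself has positive weight, which makes one
        inequality strict.\<close>
      have "\<exists>b'\<in>B m. z (m, b') * d m b' z < z (m, b') * c m z"
      proof -
        have "0 < z (m, b)"
          using eq[OF b] neg G z0[OF m b] unfolding gain_def
          by (smt (verit) mult_eq_0_iff)
        with neg b show ?thesis
          by (intro bexI[of _ b]) auto
      qed
      with le have "(\<Sum>b\<in>B m. z (m, b) * d m b z) < (\<Sum>b\<in>B m. z (m, b) * c m z)"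
        by (intro sum_strict_mono_ex1) (auto simp: B(1) m)
      also have "\<dots> = c m z"
        using z1[OF m] by (simp add: sum_distrib_right[symmetric])
      also have "\<dots> \<le> (\<Sum>b\<in>B m. z (m, b) * d m b z)"
        using jensen[OF m] z0[OF m] z1[OF m] by blast
      finally show False by simp
    qed
  qed
qed

section \<open>Monotone convex functionals\<close>

text \<open>Split off one weight and rescale the others to sum 1; then two-point convexity
  applies.\<close>

lemma convex_functional_jensen:
  fixes R :: "('x \<Rightarrow> real) \<Rightarrow> real"
  assumes convex: "\<And>L1 L2 \<alpha>. 0 \<le> \<alpha> \<Longrightarrow> \<alpha> \<le> 1 \<Longrightarrow>
      R (\<lambda>t. (1 - \<alpha>) * L1 t + \<alpha> * L2 t) \<le> (1 - \<alpha>) * R L1 + \<alpha> * R L2"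
    and B: "finite B" and w0: "\<And>b. b \<in> B \<Longrightarrow> 0 \<le> w b" and w1: "(\<Sum>b\<in>B. w b) = 1"
  shows "R (\<lambda>t. \<Sum>b\<in>B. w b * L b t) \<le> (\<Sum>b\<in>B. w b * R (L b))"
  using B w0 w1
proof (induction B arbitrary: w rule: finite_induct)
  case empty
  then show ?case by simp
next
  case (insert b B)
  have w0: "0 \<le> w b'" if "b' \<in> B" for b'
    using insert.prems(1) that by simp
  have wb: "0 \<le> w b" "(\<Sum>b\<in>B. w b) = 1 - w b"
    using insert.prems insert.hyps by auto
  have wb1: "w b \<le> 1"
    using sum_nonneg[of B w] w0 wb by auto
  show ?case
  proof (cases "w b = 1")
    \<comment> \<open>With all weight on \<open>b\<close> the rest cannot be rescaled, but it
      vanishes.\<close>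
    case True
    then have "\<forall>b\<in>B. w b = 0"
      using wb(2) w0 insert.hyps(1) by (simp add: sum_nonneg_eq_0_iff)
    with True insert.hyps show ?thesis by simp
  next
    case False
    with wb1 have pos: "0 < 1 - w b" by simp
    define v where "v b' = w b' / (1 - w b)" for b'
    have IH: "R (\<lambda>t. \<Sum>b\<in>B. v b * L b t) \<le> (\<Sum>b\<in>B. v b * R (L b))"
      using pos w0 wb(2) by (intro insert.IH) (auto simp: v_def sum_divide_distrib[symmetric])
    \<comment> \<open>\<open>X\<close> is arbitrary because the identity is used twice: for the
      losses at a point \<open>t\<close> and for their risks.\<close>
    have expand: "(\<Sum>b'\<in>insert b B. w b' * X b') = (1 - w b) * (\<Sum>b'\<in>B. v b' * X b') + w b * X b" for X
    proof -
      have "(\<Sum>b'\<in>B. w b' * X b') = (1 - w b) * (\<Sum>b'\<in>B. v b' * X b')"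
        unfolding sum_distrib_left using pos by (intro sum.cong) (auto simp: v_def)
      then show ?thesis
        using insert.hyps by simp
    qed
    have "R (\<lambda>t. \<Sum>b'\<in>insert b B. w b' * L b' t) \<le>
        (1 - w b) * R (\<lambda>t. \<Sum>b'\<in>B. v b' * L b' t) + w b * R (L b)"
      unfolding expand using wb(1) wb1 by (rule convex)
    also have "\<dots> \<le> (1 - w b) * (\<Sum>b'\<in>B. v b' * R (L b')) + w b * R (L b)"
      using IH pos by simp
    finally show ?thesis
      unfolding expand .
  qed
qed

text \<open>Monotonicity traps \<open>R (L y)\<close> between the values of \<open>R\<close> at
  \<open>L0\<close> shifted by constants, and convexity along the constant direction bounds how far
  these lie from \<open>R L0\<close>. Finiteness of \<open>C\<close> makes the convergence
  uniform.\<close>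

lemma monotone_convex_tendsto:
  fixes R :: "('x \<Rightarrow> real) \<Rightarrow> real"
  assumes mono: "\<And>L1 L2. (\<And>t. t \<in> C \<Longrightarrow> L1 t \<le> L2 t) \<Longrightarrow> R L1 \<le> R L2"
    and convex: "\<And>L1 L2 \<alpha>. 0 \<le> \<alpha> \<Longrightarrow> \<alpha> \<le> 1 \<Longrightarrow>
      R (\<lambda>t. (1 - \<alpha>) * L1 t + \<alpha> * L2 t) \<le> (1 - \<alpha>) * R L1 + \<alpha> * R L2"
    and C: "finite C" and lim: "\<And>t. t \<in> C \<Longrightarrow> ((\<lambda>y. L y t) \<longlongrightarrow> L0 t) F"
  shows "((\<lambda>y. R (L y)) \<longlongrightarrow> R L0) F"
proof (rule tendstoI)
  fix e :: real
  assume e: "0 < e"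
  \<comment> \<open>The rise of \<open>R\<close> under a unit shift; by convexity a shift by
    \<epsilon> raises \<open>R\<close> by at most \<open>\<epsilon> * D\<close>.\<close>
  define D where "D = R (\<lambda>t. L0 t + 1) - R L0"
  have D: "0 \<le> D"
    using mono[of L0 "\<lambda>t. L0 t + 1"] by (simp add: D_def)
  \<comment> \<open>The bound 1 makes \<epsilon> a convex weight; \<open>D + 1\<close> in place of
    \<open>D\<close> avoids dividing by 0 and makes \<open>small\<close> strict.\<close>
  define \<epsilon> where "\<epsilon> = min 1 (e / (D + 1))"
  have \<epsilon>: "0 < \<epsilon>" "\<epsilon> \<le> 1" "\<epsilon> \<le> e / (D + 1)"
    using e D by (auto simp: \<epsilon>_def)
  have small: "\<epsilon> * D < e"
  proof -
    have "\<epsilon> * (D + 1) \<le> e"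
      using \<epsilon>(3) D by (simp add: pos_le_divide_eq)
    with \<epsilon>(1) show ?thesis by (simp add: algebra_simps)
  qed
  have up: "R (\<lambda>t. L0 t + \<epsilon>) \<le> R L0 + \<epsilon> * D"
  proof -
    have "R (\<lambda>t. L0 t + \<epsilon>) = R (\<lambda>t. (1 - \<epsilon>) * L0 t + \<epsilon> * (L0 t + 1))"
      by (simp add: algebra_simps)
    also have "\<dots> \<le> (1 - \<epsilon>) * R L0 + \<epsilon> * R (\<lambda>t. L0 t + 1)"
      using \<epsilon> by (intro convex) auto
    finally show ?thesis by (simp add: D_def algebra_simps)
  qed
  \<comment> \<open>\<open>L0\<close> is the midpoint of the two shifts, so the fall under the shift
    down is at most the rise under the shift up.\<close>
  have down: "R L0 - \<epsilon> * D \<le> R (\<lambda>t. L0 t - \<epsilon>)"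
  proof -
    have "L0 = (\<lambda>t. (1 - 1/2) * (L0 t - \<epsilon>) + 1/2 * (L0 t + \<epsilon>))"
      by (rule ext) (simp add: field_simps)
    then have "R L0 = R (\<lambda>t. (1 - 1/2) * (L0 t - \<epsilon>) + 1/2 * (L0 t + \<epsilon>))"
      by simp
    also have "\<dots> \<le> (1 - 1/2) * R (\<lambda>t. L0 t - \<epsilon>) + 1/2 * R (\<lambda>t. L0 t + \<epsilon>)"
      by (intro convex) auto
    finally show ?thesis using up by simp
  qed
  have "\<forall>\<^sub>F y in F. \<forall>t\<in>C. dist (L y t) (L0 t) < \<epsilon>"
    using C lim \<epsilon>(1) by (intro eventually_ball_finite ballI tendstoD)
  then show "\<forall>\<^sub>F y in F. dist (R (L y)) (R L0) < e"
  proof eventually_elim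
    case (elim y)
    have "R (L y) \<le> R (\<lambda>t. L0 t + \<epsilon>)"
      using elim by (intro mono) (fastforce simp: dist_real_def)
    moreover have "R (\<lambda>t. L0 t - \<epsilon>) \<le> R (L y)"
      using elim by (intro mono) (fastforce simp: dist_real_def)
    ultimately show ?case
      using up down small by (simp add: dist_real_def abs_less_iff)
  qed
qed

section \<open>Conditional risk on a cell\<close>

lemma finite_profiles: "(\<And>i. i \<in> {1..I} \<Longrightarrow> finite (X i)) \<Longrightarrow> finite (profiles I X)"
  unfolding profiles_def by (rule finite_PiE) auto

text \<open>Values on a cell are read off at one of its points; overwriting coordinate
  \<open>i\<close> of any type profile supplies one.\<close>

lemma cell_nonempty:
  assumes "\<And>j. j \<in> {1..I} \<Longrightarrow> T j \<noteq> {}" "i \<in> {1..I}" "s \<in> T i"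
  shows "cell I T i s \<noteq> {}"
proof -
  obtain t where "t \<in> profiles I T"
    using assms(1) unfolding profiles_def by (metis PiE_eq_empty_iff ex_in_conv)
  then have "t(i := s) \<in> cell I T i s"
    using assms unfolding cell_def profiles_def
    by (auto simp: PiE_iff extensional_def)
  then show ?thesis by blast
qed

text \<open>A point at which \<open>Q\<close> fails would lie in a null set, yet it has positive
  mass. Almost sure comparisons of risks thus hold at every type profile.\<close>

lemma AE_fully_supported:
  assumes "prob_space P" "sets P = Pow (space P)" "\<And>t. t \<in> space P \<Longrightarrow> 0 < measure P {t}"
    and "AE t in P. Q t" "t \<in> space P"
  shows "Q t"
proof (rule ccontr)
  assume "\<not> Q t"
  interpret prob_space P by fact
  obtain N where N: "{t \<in> space P. \<not> Q t} \<subseteq> N" "emeasure P N = 0" "N \<in> sets P"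
    using assms(4) by (rule AE_E)
  have "measure P {t} \<le> measure P N"
    using N(1,3) \<open>\<not> Q t\<close> assms(5) by (intro finite_measure_mono) auto
  also have "\<dots> = 0"
    using N(2) by (simp add: measure_def)
  finally show False
    using assms(3)[OF assms(5)] by simp
qed

lemma Linf_finite_space:
  assumes "sets P = Pow (space P)" "finite (space P)"
  shows "L \<in> Linf P"
proof -
  have "L \<in> borel_measurable P"
    using assms(1) by (auto simp: measurable_def)
  moreover have "AE t in P. \<bar>L t\<bar> \<le> Max ((\<lambda>t. \<bar>L t\<bar>) ` space P)"
    using assms(2) by (intro AE_I2) simp
  ultimately show ?thesis
    unfolding Linf_def by blast
qed

theorem theorem2:
  fixes I :: nat
    and T :: "nat \<Rightarrow> 't set"
    and A :: "nat \<Rightarrow> 'a set"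
    and P :: "(nat \<Rightarrow> 't) measure"
    and l :: "nat \<Rightarrow> (nat \<Rightarrow> 't) \<Rightarrow> (nat \<Rightarrow> 'a) \<Rightarrow> real"
    and \<rho> :: "nat \<Rightarrow> ((nat \<Rightarrow> 't) \<Rightarrow> real) \<Rightarrow> ((nat \<Rightarrow> 't) \<Rightarrow> real)"
  assumes game: "incomplete_info_game I T A P l"
    and risk: "\<And>i. i \<in> {1..I} \<Longrightarrow> conditional_risk_functional I T P i (\<rho> i)"
    and monotone: "\<And>i L1 L2. i \<in> {1..I} \<Longrightarrow> L1 \<in> Linf P \<Longrightarrow> L2 \<in> Linf P \<Longrightarrow>
      (AE t in P. L1 t \<le> L2 t) \<Longrightarrow> (AE t in P. \<rho> i L1 t \<le> \<rho> i L2 t)"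
    and convex: "\<And>i L1 L2 \<alpha>. i \<in> {1..I} \<Longrightarrow> L1 \<in> Linf P \<Longrightarrow> L2 \<in> Linf P \<Longrightarrow>
      0 \<le> \<alpha> \<Longrightarrow> \<alpha> \<le> 1 \<Longrightarrow>
      (AE t in P. \<rho> i (\<lambda>u. (1 - \<alpha>) * L1 u + \<alpha> * L2 u) t
                    \<le> (1 - \<alpha>) * \<rho> i L1 t + \<alpha> * \<rho> i L2 t)"
  shows "\<exists>\<beta>. RABNE I T A l \<rho> \<beta>"
proof -
  have T: "\<And>i. i \<in> {1..I} \<Longrightarrow> finite (T i)" "\<And>i. i \<in> {1..I} \<Longrightarrow> T i \<noteq> {}"
    and A: "\<And>i. i \<in> {1..I} \<Longrightarrow> finite (A i)" "\<And>i. i \<in> {1..I} \<Longrightarrow> A i \<noteq> {}"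
    and P: "prob_space P" "space P = profiles I T" "sets P = Pow (profiles I T)"
    and supp: "\<And>t. t \<in> profiles I T \<Longrightarrow> 0 < measure P {t}"
    using game unfolding incomplete_info_game_def by auto
  \<comment> \<open>On a finite space with all subsets measurable every function is a bounded random
    variable, so \<open>V\<close> below acts on all functions.\<close>
  have Linf: "L \<in> Linf P" for L
    using P(2,3) finite_profiles[OF T(1)] by (simp add: Linf_finite_space)
  have AE: "Q t" if "AE t in P. Q t" "t \<in> profiles I T" for Q t
    using AE_fully_supported[of P Q t] P supp that by simp

  \<comment> \<open>Conditional risk given a type, as a real functional\<close>
  define V where "V i s L = cell_value I T i (\<rho> i L) s" for i s L
  have V_eq: "V i s L = \<rho> i L t" if "i \<in> {1..I}" "t \<in> cell I T i s" for i s L t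
    unfolding V_def
    using risk[OF that(1)] Linf cell_value_eq[OF P(3,2) _ that(2)]
    unfolding conditional_risk_functional_def by blast
  have V_mono: "V i s L1 \<le> V i s L2"
    if i: "i \<in> {1..I}" and s: "s \<in> T i" and le: "\<And>t. t \<in> cell I T i s \<Longrightarrow> L1 t \<le> L2 t" for i s L1 L2
  proof -
    obtain t where t: "t \<in> cell I T i s"
      using cell_nonempty[of I T, OF T(2) i s] by blast
    \<comment> \<open>\<open>monotone\<close> asks for an inequality almost everywhere, but only the
      cell is controlled. Off the cell \<open>L\<close> copies \<open>L1\<close>, and locality of
      the conditional risk gives \<open>L\<close> the same value as \<open>L2\<close>.\<close>
    define L where "L u = (if u \<in> cell I T i s then L2 u else L1 u)" for u
    have "AE u in P. L1 u \<le> L u"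
      using le by (simp add: L_def)
    then have "AE u in P. \<rho> i L1 u \<le> \<rho> i L u"
      by (rule monotone[OF i Linf Linf])
    then have "\<rho> i L1 t \<le> \<rho> i L t"
      by (rule AE) (use t in \<open>simp add: cell_def\<close>)
    then have "V i s L1 \<le> V i s L"
      using V_eq[OF i t] by simp
    also have "V i s L = V i s L2"
      using risk[OF i] s Linf unfolding conditional_risk_functional_def V_def
      by (simp add: L_def)
    finally show ?thesis .
  qed
  have V_convex: "V i s (\<lambda>t. (1 - \<alpha>) * L1 t + \<alpha> * L2 t) \<le> (1 - \<alpha>) * V i s L1 + \<alpha> * V i s L2"
    if i: "i \<in> {1..I}" and s: "s \<in> T i" and \<alpha>: "0 \<le> \<alpha>" "\<alpha> \<le> 1" for i s L1 L2 \<alpha>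
  proof -
    obtain t where t: "t \<in> cell I T i s"
      using cell_nonempty[of I T, OF T(2) i s] by blast
    show ?thesis
      unfolding V_eq[OF i t]
      by (rule AE[OF convex[OF i Linf Linf \<alpha>]]) (use t in \<open>simp add: cell_def\<close>)
  qed
  have V_cong: "V i s L1 = V i s L2"
    if "i \<in> {1..I}" "s \<in> T i" "\<And>t. t \<in> cell I T i s \<Longrightarrow> L1 t = L2 t" for i s L1 L2
    using that by (intro antisym V_mono) auto
  have fin_cell: "finite (cell I T i s)" for i s
    unfolding cell_def using finite_profiles[OF T(1)] by simp

  \<comment> \<open>Losses as polynomials in the mixing weights\<close>
  define loss where "loss i y t = (\<Sum>a\<in>profiles I A. l i t a * (\<Prod>j\<in>{1..I}. y ((j, t j), a j)))"
    for i t and y :: "(nat \<times> 't) \<times> 'a \<Rightarrow> real"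
  \<comment> \<open>\<open>y ((j, s), b)\<close> stands for the probability that type
    \<open>s\<close> of player \<open>j\<close> plays \<open>b\<close>, but may be any real, so that
    both losses are polynomials on the whole space. In \<open>dev\<close> the factor of player
    \<open>i\<close> is the point mass at \<open>b\<close>.\<close>
  define dev where "dev i b y t = (\<Sum>a\<in>profiles I A. l i t a *
      (\<Prod>j\<in>{1..I}. if j = i then of_bool (a j = b) else y ((j, t j), a j)))"
    for i b t and y :: "(nat \<times> 't) \<times> 'a \<Rightarrow> real"
  \<comment> \<open>On the cell of \<open>s\<close> player \<open>i\<close> enters only through the
    weights of type \<open>s\<close>, and the loss is linear in them: the point mass picks out
    \<open>b = a i\<close> from the sum.\<close>
  have loss_dev: "loss i y t = (\<Sum>b\<in>A i. y ((i, s), b) * dev i b y t)"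
    if i: "i \<in> {1..I}" and t: "t \<in> cell I T i s" for i s t y
  proof -
    have ti: "t i = s"
      using t by (simp add: cell_def)
    have "(\<Sum>b\<in>A i. y ((i, s), b) * dev i b y t) = (\<Sum>a\<in>profiles I A. l i t a *
        (\<Sum>b\<in>A i. y ((i, s), b) *
          (\<Prod>j\<in>{1..I}. if j = i then of_bool (a j = b) else y ((j, t j), a j))))"
      unfolding dev_def sum_distrib_left by (subst sum.swap) (simp add: ac_simps)
    also have "\<dots> = loss i y t"
      unfolding loss_def
    proof (intro sum.cong refl arg_cong2[where f = "(*)"])
      fix a
      assume "a \<in> profiles I A"
      then have ai: "a i \<in> A i"
        using i unfolding profiles_def by blast
      define Q where "Q = (\<Prod>j\<in>{1..I} - {i}. y ((j, t j), a j))"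
      have "(\<Prod>j\<in>{1..I}. if j = i then of_bool (a j = b) else y ((j, t j), a j)) = of_bool (a i = b) * Q" for b
        unfolding Q_def by (subst prod.remove[OF _ i]) (auto intro!: prod.cong)
      then have "(\<Sum>b\<in>A i. y ((i, s), b) *
          (\<Prod>j\<in>{1..I}. if j = i then of_bool (a j = b) else y ((j, t j), a j))) =
          (\<Sum>b\<in>A i. if b = a i then y ((i, s), b) * Q else 0)"
        by (intro sum.cong) auto
      also have "\<dots> = y ((i, s), a i) * Q"
        using ai A(1)[OF i] by simp
      also have "\<dots> = (\<Prod>j\<in>{1..I}. y ((j, t j), a j))"
        unfolding Q_def by (subst prod.remove[of "{1..I}" i]) (use i ti in auto)
      finally show "(\<Sum>b\<in>A i. y ((i, s), b) *
          (\<Prod>j\<in>{1..I}. if j = i then of_bool (a j = b) else y ((j, t j), a j))) =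
          (\<Prod>j\<in>{1..I}. y ((j, t j), a j))" .
    qed
    finally show ?thesis by simp
  qed
  have coord: "((\<lambda>y. y k) \<longlongrightarrow> y0 k) (at y0)" for k and y0 :: "(nat \<times> 't) \<times> 'a \<Rightarrow> real"
    using tendsto_ident_at[of y0 UNIV] unfolding tendsto_fun_iff by blast
  have cont_loss: "((\<lambda>y. loss i y t) \<longlongrightarrow> loss i y0 t) (at y0)" for i t y0
    unfolding loss_def by (intro tendsto_intros coord)
  have cont_dev: "((\<lambda>y. dev i b y t) \<longlongrightarrow> dev i b y0 t) (at y0)" for i b t y0
    unfolding dev_def
  proof (intro tendsto_intros)
    show "((\<lambda>y. if j = i then of_bool (a j = b) else y ((j, t j), a j)) \<longlongrightarrow>
        (if j = i then of_bool (a j = b) else y0 ((j, t j), a j))) (at y0)" for j a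
      by (cases "j = i") (simp_all add: coord)
  qed
  have V_tendsto: "((\<lambda>y. V i s (L y)) \<longlongrightarrow> V i s L0) F"
    if "i \<in> {1..I}" "s \<in> T i" "\<And>t. t \<in> cell I T i s \<Longrightarrow> ((\<lambda>y. L y t) \<longlongrightarrow> L0 t) F"
    for i s L0 F and L :: "((nat \<times> 't) \<times> 'a \<Rightarrow> real) \<Rightarrow> (nat \<Rightarrow> 't) \<Rightarrow> real"
    by (rule monotone_convex_tendsto[where R = "V i s", OF V_mono[OF that(1,2)] V_convex[OF that(1,2)]
          fin_cell that(3)])

  \<comment> \<open>Nash's map for the agent form\<close>
  let ?J = "Sigma {1..I} T"
  obtain y where y0: "\<And>m b. m \<in> ?J \<Longrightarrow> b \<in> A (fst m) \<Longrightarrow> 0 \<le> y (m, b)"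
    and y1: "\<And>m. m \<in> ?J \<Longrightarrow> (\<Sum>b\<in>A (fst m). y (m, b)) = 1"
    and opt: "\<And>m b. m \<in> ?J \<Longrightarrow> b \<in> A (fst m) \<Longrightarrow>
      V (fst m) (snd m) (loss (fst m) y) \<le> V (fst m) (snd m) (dev (fst m) b y)"
  proof (rule exists_no_profitable_pure_deviation[of ?J "\<lambda>m. A (fst m)"
        "\<lambda>m y. V (fst m) (snd m) (loss (fst m) y)" "\<lambda>m b y. V (fst m) (snd m) (dev (fst m) b y)"])
    show "finite ?J"
      using T(1) by (intro finite_SigmaI) auto
  next
    fix m assume m: "m \<in> ?J"
    then have i: "fst m \<in> {1..I}" and s: "snd m \<in> T (fst m)" by auto
    show "finite (A (fst m))" "A (fst m) \<noteq> {}"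
      using A i by auto
    show "continuous_on UNIV (\<lambda>y. V (fst m) (snd m) (loss (fst m) y))"
      unfolding continuous_on_def using V_tendsto[OF i s cont_loss] by simp
    show "continuous_on UNIV (\<lambda>y. V (fst m) (snd m) (dev (fst m) b y))" for b
      unfolding continuous_on_def using V_tendsto[OF i s cont_dev] by simp
    fix y :: "(nat \<times> 't) \<times> 'a \<Rightarrow> real"
    assume y: "\<And>b. b \<in> A (fst m) \<Longrightarrow> 0 \<le> y (m, b)" "(\<Sum>b\<in>A (fst m). y (m, b)) = 1"
    \<comment> \<open>On the cell the loss is the mixture of the deviation losses, so convexity of
      the conditional risk yields Jensen's inequality for this agent.\<close>
    have "V (fst m) (snd m) (loss (fst m) y) =
        V (fst m) (snd m) (\<lambda>t. \<Sum>b\<in>A (fst m). y (m, b) * dev (fst m) b y t)"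
      using loss_dev[OF i] by (intro V_cong[OF i s]) simp
    also have "\<dots> \<le> (\<Sum>b\<in>A (fst m). y (m, b) * V (fst m) (snd m) (dev (fst m) b y))"
      using A(1)[OF i] y
      by (intro convex_functional_jensen[where R = "V (fst m) (snd m)", OF V_convex[OF i s]])
    finally show "V (fst m) (snd m) (loss (fst m) y) \<le>
        (\<Sum>b\<in>A (fst m). y (m, b) * V (fst m) (snd m) (dev (fst m) b y))" .
  qed (use that in blast)

  \<comment> \<open>From weights back to behavioral strategies\<close>
  define \<beta> where "\<beta> = (\<lambda>i\<in>{1..I}. \<lambda>s\<in>T i.
      embed_pmf (\<lambda>b. if b \<in> A i then y ((i, s), b) else 0))"
  have pmf_\<beta>: "pmf (\<beta> i s) b = (if b \<in> A i then y ((i, s), b) else 0)"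
    if i: "i \<in> {1..I}" and s: "s \<in> T i" for i s b
  proof -
    \<comment> \<open>Zero weight off \<open>A i\<close> makes \<open>w\<close> a density on the
      whole action type, of mass 1 by \<open>y1\<close>.\<close>
    define w where "w b = (if b \<in> A i then y ((i, s), b) else 0)" for b
    have w0: "0 \<le> w b" for b
      using y0[of "(i, s)"] i s by (simp add: w_def)
    have "(\<integral>\<^sup>+b. ennreal (w b) \<partial>count_space UNIV) = (\<integral>\<^sup>+b. ennreal (w b) \<partial>count_space (A i))"
      by (intro nn_integral_count_space_eq) (auto simp: w_def)
    also have "\<dots> = ennreal (\<Sum>b\<in>A i. w b)"
      using A(1)[OF i] w0 by (simp add: nn_integral_count_space_finite)
    also have "(\<Sum>b\<in>A i. w b) = 1"
      using y1[of "(i, s)"] i s by (simp add: w_def)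
    finally have "pmf (embed_pmf w) b = w b"
      using w0 by (intro pmf_embed_pmf) auto
    moreover have "\<beta> i s = embed_pmf w"
      using i s by (simp add: \<beta>_def w_def[abs_def])
    ultimately show ?thesis
      by (simp add: w_def)
  qed
  have "set_pmf (\<beta> i s) \<subseteq> A i" if "i \<in> {1..I}" "s \<in> T i" for i s
    using pmf_\<beta>[OF that] by (auto simp: set_pmf_eq split: if_splits)
  then have \<beta>_prof: "\<beta> \<in> strategy_profiles I T A"
    unfolding strategy_profiles_def profiles_def strategies_def
    by (auto simp: \<beta>_def PiE_iff)
  have tT: "t j \<in> T j" if "t \<in> cell I T i s" "j \<in> {1..I}" for t i s j
    using that unfolding cell_def profiles_def by auto
  have aA: "a j \<in> A j" if "a \<in> profiles I A" "j \<in> {1..I}" for a j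
    using that unfolding profiles_def by auto
  have rl: "random_loss I A l i \<beta> t = loss i y t" if "t \<in> cell I T i s" for i s t
    unfolding random_loss_def loss_def
    using pmf_\<beta> tT[OF that] aA by (intro sum.cong refl arg_cong2[where f = "(*)"] prod.cong) auto
  \<comment> \<open>The deviation switches to \<open>b\<close> at every type of player
    \<open>i\<close>; on the cell of \<open>s\<close> only the switch at \<open>s\<close> enters, so
    this is the deviation of the agent \<open>(i, s)\<close>.\<close>
  have rd: "random_loss I A l i (deviation T \<beta> i b) t = dev i b y t"
    if "t \<in> cell I T i s" for i s b t
    unfolding random_loss_def dev_def deviation_def
    using pmf_\<beta> tT[OF that] aA
    by (intro sum.cong refl arg_cong2[where f = "(*)"] prod.cong) (auto simp: indicator_def)
  have "V i s (random_loss I A l i \<beta>) \<le> V i s (random_loss I A l i (deviation T \<beta> i b))"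
    if i: "i \<in> {1..I}" and s: "s \<in> T i" and b: "b \<in> A i" for i s b
  proof -
    have "V i s (random_loss I A l i \<beta>) = V i s (loss i y)"
      by (rule V_cong[OF i s rl])
    also have "\<dots> \<le> V i s (dev i b y)"
      using opt[of "(i, s)" b] i s b by simp
    also have "\<dots> = V i s (random_loss I A l i (deviation T \<beta> i b))"
      by (rule V_cong[OF i s rd[symmetric]])
    finally show ?thesis .
  qed
  with \<beta>_prof have "RABNE I T A l \<rho> \<beta>"
    unfolding RABNE_def V_def by blast
  then show ?thesis by blast
qed

end
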